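(* Let $\{x^k\}_{k\in\mathbb{N}}$ be a sequence generated by the Augmented Lagrangian Method (described in the context) applied to (CTP), and let $\bar{x}\in L^\infty([0,T];\mathbb{R}^n)$ satisfy $x^k(t)\to\bar{x}(t)$ for a.e. $t\in[0,T]$. If $\bar{x}$ is a feasible solution for (CTP), i.e. $\bar{x}\in\Omega$, and hypotheses (H1), (H2) (at $\bar{x}$) and (H3), stated in the context, are satisfied, then $\bar{x}$ is a pw-AKKT solution for (CTP).
   Context: Let $T>0$ and let $\phi:\mathbb{R}^n\times[0,T]\to\mathbb{R}$, $h=(h_1,\dots,h_p):\mathbb{R}^n\times[0,T]\to\mathbb{R}^p$, $g=(g_1,\dots,g_m):\mathbb{R}^n\times[0,T]\to\mathbb{R}^m$ be given functions. Integrals are Lebesgue integrals and vector inequalities are componentwise. Problem (CTP) is: minimize $P(x)=\int_0^T\phi(x(t),t)\,dt$ over $x\in L^\infty([0,T];\mathbb{R}^n)$ subject to $h(x(t),t)=0$ and $g(x(t),t)\le 0$ for a.e. $t\in[0,T]$. Its feasible set is $$\Omega=\{x\in L^\infty([0,T];\mathbb{R}^n): h(x(t),t)=0,\ g(x(t),t)\le 0 \text{ a.e. } t\in[0,T]\}.$$ For $r>0$ put $\bar{B}_r(t)=\{x\in\mathbb{R}^n:\|x-\bar{x}(t)\|\le r\}$. The Lagrangian is $L(x,u,v,t)=\phi(x,t)+\sum_{i=1}^p u_ih_i(x,t)+\sum_{j=1}^m v_jg_j(x,t)$, and $g_j^-(x,t)=\max\{-g_j(x,t),0\}$. (H1)–(H2)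 at $\bar{x}$: there exists $r>0$ such that: (H1) $\phi(\cdot,t)$ is continuously differentiable for a.e. $t\in[0,T]$; $\phi(x,\cdot)$ is Lebesgue measurable for each $x$; $|\phi(\bar{x}(\cdot),\cdot)|$ is integrable on $[0,T]$; there is an integrable function $c_\phi$ on $[0,T]$ with $|\phi(x,t)-\phi(y,t)|\le c_\phi(t)\|x-y\|$ for all $x,y\in\bar{B}_r(t)$, a.e. $t\in[0,T]$. (H2) $(h,g)(\cdot,t)$ is continuously differentiable for a.e. $t\in[0,T]$; $(h,g)(x,\cdot)$ is Lebesgue measurable for each $x$; $\|(h,g)(\bar{x}(\cdot),\cdot)\|$ is integrable on $[0,T]$; there is an integrable function $c_{h,g}$ on $[0,T]$ with $\|(h,g)(x,t)-(h,g)(y,t)\|\le c_{h,g}(t)\|x-y\|$ for all $x,y\in\bar{B}_r(t)$, a.e. $t\in[0,T]$. A sequence $\{(x^{k},u^{k},v^{k})\}_{k\in\mathbb{N}}\subset L^{\infty}([0,T];\mathbb{R}^{n}\times\mathbb{R}^{p}\times\mathbb{R}^{m})$ is an AKKT sequence for (CTP) if (i) $\int_0^T\nabla_xL(x^k(t),u^k(t),v^k(t),t)\cdot\gamma(t)\,dt\to 0$ for all $\gamma\in L^\infty([0,T];\mathbb{R}^n)$; (ii) $v_j^k(t)g_j^-(x^k(t),t)\to 0$ for a.e. $t\in[0,T]$, $j=1,\dots,m$; (iii) $v_j^k(t)\ge 0$ for a.e. $t\in[0,T]$, $j=1,\dots,m$, and all $k$. A point $\bar{x}\in\Omega$ at which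 (H1) and (H2) hold is a pw-AKKT solution for (CTP) if there exists an AKKT sequence $\{(x^k,u^k,v^k)\}_{k\in\mathbb{N}}$ for (CTP) with $x^k(t)\to\bar{x}(t)$ for a.e. $t\in[0,T]$. Augmented Lagrangian: for $\rho>0$, $$L_\rho(x,u,v,t)=\phi(x,t)+\frac{\rho}{2}\sum_{i=1}^p\Big[h_i(x,t)+\frac{u_i}{\rho}\Big]^2+\frac{\rho}{2}\sum_{j=1}^m\Big[\max\Big\{0,g_j(x,t)+\frac{v_j}{\rho}\Big\}\Big]^2 .$$ Augmented Lagrangian Method. Parameters: $M,N>0$, $\gamma>1$, $\rho_1>0$, $\tau\in(0,1)$. Initial data: $\tilde{u}^1\in L^\infty([0,T];\mathbb{R}^p)$ and $\tilde{v}^1\in L^\infty([0,T];\mathbb{R}^m_+)$ with $\tilde{u}^1_i(t)\in[-M,M]$ and $\tilde{v}^1_j(t)\in[0,N]$ for a.e. $t$ and all $i,j$; an arbitrary $x^0\in L^\infty([0,T];\mathbb{R}^n)$; $V^0_j(t)=\max\{g_j(x^0(t),t),0\}$ and $H^0(t)=h(x^0(t),t)$. For $k=1,2,\dots$: - Compute an approximate solution $x^k\in L^\infty([0,T];\mathbb{R}^n)$ of the problem of minimizing $\int_0^TL_{\rho_k}(x(t),\tilde{u}^k(t),\tilde{v}^k(t),t)\,dt$ over $x\in L^\infty([0,T];\mathbb{R}^n)$; the meaning of "approximate solution" is given by (H3) below. - Define $V^k\in L^\infty([0,T];\mathbb{R}^m)$ and $H^k\in L^\infty([0,T];\mathbb{R}^p)$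 by $V^k_j(t)=\max\{g_j(x^k(t),t),-\tilde{v}^k_j(t)/\rho_k\}$ and $H^k(t)=h(x^k(t),t)$ (these are understood to be essentially bounded). If $\max\{\|H^k\|_\infty,\|V^k\|_\infty\}\le\tau\max\{\|H^{k-1}\|_\infty,\|V^{k-1}\|_\infty\}$, set $\rho_{k+1}=\rho_k$; otherwise set $\rho_{k+1}=\gamma\rho_k$. - Set $u_i^k(t)=\tilde{u}_i^k(t)+\rho_kh_i(x^k(t),t)$ and $v_j^k(t)=\max\{\tilde{v}_j^k(t)+\rho_kg_j(x^k(t),t),0\}$; then $\tilde{u}_i^{k+1}(t)=\mathrm{proj}_{[-M,M]}(u_i^k(t))$ and $\tilde{v}_j^{k+1}(t)=\mathrm{proj}_{[0,N]}(v_j^k(t))$. A sequence generated by the method means an infinite sequence $\{x^k\}_{k\in\mathbb{N}}$ produced in this way (no stopping test terminates it). (H3) There exists a sequence $\{\varepsilon^k\}_{k\in\mathbb{N}}\subset L^1([0,T];\mathbb{R}^n)$ with $\varepsilon^k\rightharpoonup 0$ weakly in $L^1([0,T];\mathbb{R}^n)$ such that $\nabla_xL_{\rho_k}(x^k(t),\tilde{u}^k(t),\tilde{v}^k(t),t)=\varepsilon^k(t)$ for a.e. $t\in[0,T]$ and all $k\in\mathbb{N}$. *)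

theory Defs
  imports "HOL-Analysis.Analysis" "HOL-Probability.Essential_Supremum"
begin

section \<open>Function spaces on \<open>[0,T]\<close>\<close>

abbreviation IT :: "real \<Rightarrow> real measure"
  where "IT T \<equiv> lebesgue_on {0..T}"

text \<open>The spaces below consist of functions rather than of classes modulo equality a.e.\<close>

definition Linf :: "real \<Rightarrow> (real \<Rightarrow> 'a::euclidean_space) set"
  where "Linf T = {f \<in> borel_measurable (IT T). \<exists>C. AE t in IT T. norm (f t) \<le> C}"

definition L1 :: "real \<Rightarrow> (real \<Rightarrow> 'a::euclidean_space) set"
  where "L1 T = {f. integrable (IT T) f}"

text \<open>Extended-real valued, with the Euclidean norm on the codomain.\<close>

definition Linf_norm :: "real \<Rightarrow> (real \<Rightarrow> 'a::euclidean_space) \<Rightarrow> ereal"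
  where "Linf_norm T f = esssup (IT T) (\<lambda>t. ereal (norm (f t)))"

text \<open>Boundedness with respect to the \<open>L1\<close> norm forces \<open>\<Lambda>\<close> to respect equality a.e.,
  so these are exactly the elements of the dual of the quotient space.\<close>

definition L1_dual :: "real \<Rightarrow> ((real \<Rightarrow> 'a::euclidean_space) \<Rightarrow> real) set"
  where "L1_dual T = {\<Lambda>.
     (\<forall>f\<in>L1 T. \<forall>g\<in>L1 T. \<Lambda> (\<lambda>t. f t + g t) = \<Lambda> f + \<Lambda> g) \<and>
     (\<forall>c. \<forall>f\<in>L1 T. \<Lambda> (\<lambda>t. c *\<^sub>R f t) = c * \<Lambda> f) \<and>
     (\<exists>C. \<forall>f\<in>L1 T. \<bar>\<Lambda> f\<bar> \<le> C * (LINT t|IT T. norm (f t)))}"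

definition weakly_converges_L1 ::
    "real \<Rightarrow> (nat \<Rightarrow> real \<Rightarrow> 'a::euclidean_space) \<Rightarrow> (real \<Rightarrow> 'a) \<Rightarrow> bool"
  where "weakly_converges_L1 T f f0 \<longleftrightarrow> (\<forall>\<Lambda>\<in>L1_dual T. (\<lambda>k. \<Lambda> (f k)) \<longlonglongrightarrow> \<Lambda> f0)"


section \<open>Differentiability\<close>

definition grad :: "('a::euclidean_space \<Rightarrow> real) \<Rightarrow> 'a \<Rightarrow> 'a"
  where "grad f x = (THE D. GDERIV f x :> D)"

definition continuously_differentiable ::
    "('a::euclidean_space \<Rightarrow> 'b::euclidean_space) \<Rightarrow> bool"
  where "continuously_differentiable f \<longleftrightarrow>
     (\<exists>f' :: 'a \<Rightarrow> 'a \<Rightarrow>\<^sub>L 'b.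
        (\<forall>x. (f has_derivative blinfun_apply (f' x)) (at x)) \<and> continuous_on UNIV f')"

lemma grad_eqI:
  assumes "GDERIV f x :> D"
  shows "grad f x = D"
  unfolding grad_def
proof (rule the_equality)
  show "GDERIV f x :> D" by fact
next
  fix D' assume "GDERIV f x :> D'"
  with assms have "(\<lambda>y. y \<bullet> D') = (\<lambda>y. y \<bullet> D)"
    unfolding gderiv_def by (rule has_derivative_unique[rotated])
  then show "D' = D"
    by (metis vector_eq_ldot)
qed


section \<open>The continuous-time problem\<close>

text \<open>The data are total functions; only their values for \<open>t \<in> [0,T]\<close> matter.\<close>

definition feasible_set ::
    "real \<Rightarrow> (real^'n \<Rightarrow> real \<Rightarrow> real^'p) \<Rightarrow> (real^'n \<Rightarrow> real \<Rightarrow> real^'m) \<Rightarrow> (real \<Rightarrow> real^'n) set"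
  where "feasible_set T h g =
     {x \<in> Linf T. AE t in IT T. h (x t) t = 0 \<and> (\<forall>j. g (x t) t $ j \<le> 0)}"

definition Lagrangian ::
    "(real^'n \<Rightarrow> real \<Rightarrow> real) \<Rightarrow> (real^'n \<Rightarrow> real \<Rightarrow> real^'p) \<Rightarrow> (real^'n \<Rightarrow> real \<Rightarrow> real^'m)
     \<Rightarrow> real^'n \<Rightarrow> real^'p \<Rightarrow> real^'m \<Rightarrow> real \<Rightarrow> real"
  where "Lagrangian \<phi> h g x u v t =
     \<phi> x t + (\<Sum>i\<in>UNIV. u $ i * h x t $ i) + (\<Sum>j\<in>UNIV. v $ j * g x t $ j)"

definition aug_Lagrangian ::
    "(real^'n \<Rightarrow> real \<Rightarrow> real) \<Rightarrow> (real^'n \<Rightarrow> real \<Rightarrow> real^'p) \<Rightarrow> (real^'n \<Rightarrow> real \<Rightarrow> real^'m)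
     \<Rightarrow> real \<Rightarrow> real^'n \<Rightarrow> real^'p \<Rightarrow> real^'m \<Rightarrow> real \<Rightarrow> real"
  where "aug_Lagrangian \<phi> h g \<rho> x u v t =
     \<phi> x t + \<rho> / 2 * (\<Sum>i\<in>UNIV. (h x t $ i + u $ i / \<rho>)\<^sup>2)
           + \<rho> / 2 * (\<Sum>j\<in>UNIV. (max 0 (g x t $ j + v $ j / \<rho>))\<^sup>2)"

definition H1 :: "real \<Rightarrow> (real^'n \<Rightarrow> real \<Rightarrow> real) \<Rightarrow> (real \<Rightarrow> real^'n) \<Rightarrow> real \<Rightarrow> bool"
  where "H1 T \<phi> xbar r \<longleftrightarrow>
     (AE t in IT T. continuously_differentiable (\<lambda>x. \<phi> x t)) \<and>
     (\<forall>x. (\<lambda>t. \<phi> x t) \<in> borel_measurable (IT T)) \<and>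
     integrable (IT T) (\<lambda>t. \<bar>\<phi> (xbar t) t\<bar>) \<and>
     (\<exists>c. integrable (IT T) c \<and>
        (AE t in IT T. \<forall>x\<in>cball (xbar t) r. \<forall>y\<in>cball (xbar t) r.
           \<bar>\<phi> x t - \<phi> y t\<bar> \<le> c t * norm (x - y)))"

definition H2 ::
    "real \<Rightarrow> (real^'n \<Rightarrow> real \<Rightarrow> real^'p) \<Rightarrow> (real^'n \<Rightarrow> real \<Rightarrow> real^'m)
     \<Rightarrow> (real \<Rightarrow> real^'n) \<Rightarrow> real \<Rightarrow> bool"
  where "H2 T h g xbar r \<longleftrightarrow>
     (AE t in IT T. continuously_differentiable (\<lambda>x. (h x t, g x t))) \<and>
     (\<forall>x. (\<lambda>t. (h x t, g x t)) \<in> borel_measurable (IT T)) \<and>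
     integrable (IT T) (\<lambda>t. norm (h (xbar t) t, g (xbar t) t)) \<and>
     (\<exists>c. integrable (IT T) c \<and>
        (AE t in IT T. \<forall>x\<in>cball (xbar t) r. \<forall>y\<in>cball (xbar t) r.
           norm ((h x t, g x t) - (h y t, g y t)) \<le> c t * norm (x - y)))"

text \<open>The radius \<open>r\<close> is common to both hypotheses.\<close>

definition H1_H2 ::
    "real \<Rightarrow> (real^'n \<Rightarrow> real \<Rightarrow> real) \<Rightarrow> (real^'n \<Rightarrow> real \<Rightarrow> real^'p) \<Rightarrow> (real^'n \<Rightarrow> real \<Rightarrow> real^'m)
     \<Rightarrow> (real \<Rightarrow> real^'n) \<Rightarrow> bool"
  where "H1_H2 T \<phi> h g xbar \<longleftrightarrow> (\<exists>r>0. H1 T \<phi> xbar r \<and> H2 T h g xbar r)"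


section \<open>AKKT sequences and pw-AKKT solutions\<close>

text \<open>Integrability is required explicitly since the Bochner integral of a non-integrable
  function is \<open>0\<close> by convention. The factor \<open>max (- g) 0\<close> is the negative part of \<open>g\<close>.\<close>

definition AKKT_sequence ::
    "real \<Rightarrow> (real^'n \<Rightarrow> real \<Rightarrow> real) \<Rightarrow> (real^'n \<Rightarrow> real \<Rightarrow> real^'p) \<Rightarrow> (real^'n \<Rightarrow> real \<Rightarrow> real^'m)
     \<Rightarrow> (nat \<Rightarrow> real \<Rightarrow> real^'n) \<Rightarrow> (nat \<Rightarrow> real \<Rightarrow> real^'p) \<Rightarrow> (nat \<Rightarrow> real \<Rightarrow> real^'m) \<Rightarrow> bool"
  where "AKKT_sequence T \<phi> h g x u v \<longleftrightarrow>
     (\<forall>k. x k \<in> Linf T \<and> u k \<in> Linf T \<and> v k \<in> Linf T) \<and>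
     (\<forall>\<gamma>\<in>Linf T.
        (\<forall>k. integrable (IT T)
           (\<lambda>t. grad (\<lambda>y. Lagrangian \<phi> h g y (u k t) (v k t) t) (x k t) \<bullet> \<gamma> t)) \<and>
        (\<lambda>k. LINT t|IT T.
           grad (\<lambda>y. Lagrangian \<phi> h g y (u k t) (v k t) t) (x k t) \<bullet> \<gamma> t) \<longlonglongrightarrow> 0) \<and>
     (\<forall>j. AE t in IT T. (\<lambda>k. v k t $ j * max (- g (x k t) t $ j) 0) \<longlonglongrightarrow> 0) \<and>
     (\<forall>k j. AE t in IT T. 0 \<le> v k t $ j)"

definition pw_AKKT_solution ::
    "real \<Rightarrow> (real^'n \<Rightarrow> real \<Rightarrow> real) \<Rightarrow> (real^'n \<Rightarrow> real \<Rightarrow> real^'p) \<Rightarrow> (real^'n \<Rightarrow> real \<Rightarrow> real^'m)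
     \<Rightarrow> (real \<Rightarrow> real^'n) \<Rightarrow> bool"
  where "pw_AKKT_solution T \<phi> h g xbar \<longleftrightarrow>
     xbar \<in> feasible_set T h g \<and> H1_H2 T \<phi> h g xbar \<and>
     (\<exists>x u v. AKKT_sequence T \<phi> h g x u v \<and>
        (AE t in IT T. (\<lambda>k. x k t) \<longlonglongrightarrow> xbar t))"


section \<open>The augmented Lagrangian method\<close>

text \<open>\<open>ut\<close> and \<open>vt\<close> are the safeguarded multipliers (written with a tilde in the literature).
  Iterations are numbered from \<open>1\<close>; index \<open>0\<close> is used only for the starting point \<open>x 0\<close>,
  and \<open>\<rho> 0\<close>, \<open>ut 0\<close>, \<open>vt 0\<close> are irrelevant.\<close>

definition ALM_H ::
    "(real^'n \<Rightarrow> real \<Rightarrow> real^'p) \<Rightarrow> (nat \<Rightarrow> real \<Rightarrow> real^'n) \<Rightarrow> nat \<Rightarrow> real \<Rightarrow> real^'p"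
  where "ALM_H h x k t = h (x k t) t"

definition ALM_V ::
    "(real^'n \<Rightarrow> real \<Rightarrow> real^'m) \<Rightarrow> (nat \<Rightarrow> real \<Rightarrow> real^'n) \<Rightarrow> (nat \<Rightarrow> real \<Rightarrow> real^'m)
     \<Rightarrow> (nat \<Rightarrow> real) \<Rightarrow> nat \<Rightarrow> real \<Rightarrow> real^'m"
  where "ALM_V g x vt \<rho> k t =
     (\<chi> j. if k = 0 then max (g (x 0 t) t $ j) 0
           else max (g (x k t) t $ j) (- vt k t $ j / \<rho> k))"

definition ALM_u ::
    "(real^'n \<Rightarrow> real \<Rightarrow> real^'p) \<Rightarrow> (nat \<Rightarrow> real \<Rightarrow> real^'n) \<Rightarrow> (nat \<Rightarrow> real \<Rightarrow> real^'p)
     \<Rightarrow> (nat \<Rightarrow> real) \<Rightarrow> nat \<Rightarrow> real \<Rightarrow> real^'p"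
  where "ALM_u h x ut \<rho> k t = (\<chi> i. ut k t $ i + \<rho> k * h (x k t) t $ i)"

definition ALM_v ::
    "(real^'n \<Rightarrow> real \<Rightarrow> real^'m) \<Rightarrow> (nat \<Rightarrow> real \<Rightarrow> real^'n) \<Rightarrow> (nat \<Rightarrow> real \<Rightarrow> real^'m)
     \<Rightarrow> (nat \<Rightarrow> real) \<Rightarrow> nat \<Rightarrow> real \<Rightarrow> real^'m"
  where "ALM_v g x vt \<rho> k t = (\<chi> j. max (vt k t $ j + \<rho> k * g (x k t) t $ j) 0)"

definition ALM_residual ::
    "real \<Rightarrow> (real^'n \<Rightarrow> real \<Rightarrow> real^'p) \<Rightarrow> (real^'n \<Rightarrow> real \<Rightarrow> real^'m)
     \<Rightarrow> (nat \<Rightarrow> real \<Rightarrow> real^'n) \<Rightarrow> (nat \<Rightarrow> real \<Rightarrow> real^'m) \<Rightarrow> (nat \<Rightarrow> real) \<Rightarrow> nat \<Rightarrow> ereal"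
  where "ALM_residual T h g x vt \<rho> k =
     max (Linf_norm T (ALM_H h x k)) (Linf_norm T (ALM_V g x vt \<rho> k))"

text \<open>This predicate contains everything except the sense in which \<open>x k\<close> approximately
  minimizes the augmented Lagrangian functional; that sense is \<open>H3\<close> below.
  The projection onto an interval is \<^const>\<open>closest_point\<close>.\<close>

definition ALM_sequence ::
    "real \<Rightarrow> (real^'n \<Rightarrow> real \<Rightarrow> real^'p) \<Rightarrow> (real^'n \<Rightarrow> real \<Rightarrow> real^'m)
     \<Rightarrow> real \<Rightarrow> real \<Rightarrow> real \<Rightarrow> real \<Rightarrow> real
     \<Rightarrow> (nat \<Rightarrow> real \<Rightarrow> real^'n) \<Rightarrow> (nat \<Rightarrow> real \<Rightarrow> real^'p) \<Rightarrow> (nat \<Rightarrow> real \<Rightarrow> real^'m)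
     \<Rightarrow> (nat \<Rightarrow> real) \<Rightarrow> bool"
  where "ALM_sequence T h g M N \<gamma> \<rho>1 \<tau> x ut vt \<rho> \<longleftrightarrow>
     (\<forall>k. x k \<in> Linf T) \<and>
     \<rho> 1 = \<rho>1 \<and>
     ut 1 \<in> Linf T \<and> (AE t in IT T. \<forall>i. ut 1 t $ i \<in> {-M..M}) \<and>
     vt 1 \<in> Linf T \<and> (AE t in IT T. \<forall>j. vt 1 t $ j \<in> {0..N}) \<and>
     (\<forall>k\<ge>1.
        ALM_H h x k \<in> Linf T \<and> ALM_V g x vt \<rho> k \<in> Linf T \<and>
        \<rho> (Suc k) =
          (if ALM_residual T h g x vt \<rho> k \<le> ereal \<tau> * ALM_residual T h g x vt \<rho> (k - 1)
           then \<rho> k else \<gamma> * \<rho> k) \<and>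
        (AE t in IT T. \<forall>i. ut (Suc k) t $ i = closest_point {-M..M} (ALM_u h x ut \<rho> k t $ i)) \<and>
        (AE t in IT T. \<forall>j. vt (Suc k) t $ j = closest_point {0..N} (ALM_v g x vt \<rho> k t $ j)))"

definition H3 ::
    "real \<Rightarrow> (real^'n \<Rightarrow> real \<Rightarrow> real) \<Rightarrow> (real^'n \<Rightarrow> real \<Rightarrow> real^'p) \<Rightarrow> (real^'n \<Rightarrow> real \<Rightarrow> real^'m)
     \<Rightarrow> (nat \<Rightarrow> real \<Rightarrow> real^'n) \<Rightarrow> (nat \<Rightarrow> real \<Rightarrow> real^'p) \<Rightarrow> (nat \<Rightarrow> real \<Rightarrow> real^'m)
     \<Rightarrow> (nat \<Rightarrow> real) \<Rightarrow> bool"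
  where "H3 T \<phi> h g x ut vt \<rho> \<longleftrightarrow>
     (\<exists>\<epsilon>. (\<forall>k\<ge>1. \<epsilon> k \<in> L1 T) \<and> weakly_converges_L1 T \<epsilon> (\<lambda>_. 0) \<and>
        (\<forall>k\<ge>1. AE t in IT T.
           grad (\<lambda>y. aug_Lagrangian \<phi> h g (\<rho> k) y (ut k t) (vt k t) t) (x k t) = \<epsilon> k t))"

end

theory Submission
  imports Defs
begin

text \<open>By the choice of the multipliers \<open>u\<^sup>k\<close>, \<open>v\<^sup>k\<close>, the gradient of the Lagrangian at
  \<open>(x\<^sup>k, u\<^sup>k, v\<^sup>k)\<close> is the gradient of the augmented Lagrangian at \<open>x\<^sup>k\<close>, that is, \<open>\<epsilon>\<^sup>k\<close>; pairing with an
  essentially bounded function is a continuous functional on \<open>L\<^sup>1\<close>, so the integrals tend to \<open>0\<close>.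
  For complementarity, \<open>v\<^sub>j\<^sup>k g\<^sub>j\<^sup>-\<close> can be nonzero only if \<open>0 < - g\<^sub>j < vt\<^sub>j\<^sup>k / \<rho>\<^sub>k\<close>, and it is
  then at most \<open>N \<bar>V\<^sub>j\<^sup>k\<bar>\<close> and at most \<open>N\<^sup>2 / \<rho>\<^sub>k\<close>. Either the penalty test succeeds eventually and
  \<open>V\<^sup>k\<close> decays geometrically, or it fails infinitely often and \<open>\<rho>\<^sub>k\<close> tends to infinity.\<close>

subsection \<open>Essentially bounded functions\<close>

text \<open>Completeness of Lebesgue measure, applied to the extensions by zero off
  \<open>S\<close>. It is needed because the projected multipliers and the gradients are prescribed
  only almost everywhere.\<close>

lemma borel_measurable_lebesgue_on_AE:
  fixes f g :: "'a::euclidean_space \<Rightarrow> 'b::euclidean_space"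
  assumes "f \<in> borel_measurable (lebesgue_on S)" "AE x in lebesgue_on S. f x = g x"
    and "S \<in> sets lebesgue"
  shows "g \<in> borel_measurable (lebesgue_on S)"
proof -
  let ?r = "\<lambda>f x. if x \<in> S then f x else 0"
  have "?r f \<in> borel_measurable lebesgue"
    using assms(1,3) by (simp add: borel_measurable_if)
  moreover have "AE x in lebesgue. ?r f x = ?r g x"
    using assms(2,3) by (auto simp: AE_restrict_space_iff)
  ultimately have "?r g \<in> borel_measurable lebesgue"
    by (rule borel_measurable_AE)
  then show ?thesis
    using assms(3) by (simp add: borel_measurable_if)
qed

lemma Linf_scaleR_add:
  assumes "f \<in> Linf T" "g \<in> Linf T"
  shows "(\<lambda>t. f t + c *\<^sub>R g t) \<in> Linf T"
proof -
  obtain A B where "AE t in IT T. norm (f t) \<le> A" "AE t in IT T. norm (g t) \<le> B"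
    using assms by (auto simp: Linf_def)
  then have "AE t in IT T. norm (f t + c *\<^sub>R g t) \<le> A + \<bar>c\<bar> * B"
  proof eventually_elim
    case (elim t)
    then show ?case
      by (intro norm_triangle_mono) (auto intro: mult_left_mono)
  qed
  then show ?thesis
    using assms by (auto simp: Linf_def)
qed

text \<open>Projection onto a nonempty closed interval is continuous, so applying it componentwise
  to \<open>w\<close> preserves measurability, and its values lie in a bounded box. Completeness
  passes measurability on to \<open>f\<close>, which agrees with the projection only almost
  everywhere.\<close>

lemma Linf_closest_point:
  fixes f w :: "real \<Rightarrow> real^'n"
  assumes "w \<in> borel_measurable (IT T)" "a \<le> b"
    and f: "AE t in IT T. \<forall>i. f t $ i = closest_point {a..b} (w t $ i)"
  shows "f \<in> Linf T"
proof -
  define P where "P = (\<lambda>y::real^'n. \<chi> i. closest_point {a..b} (y $ i))"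
  have cont: "continuous_on UNIV (closest_point {a..b})"
    using \<open>a \<le> b\<close> by (intro continuous_on_closest_point) auto
  have "continuous_on UNIV P"
    unfolding P_def
    by (intro continuous_on_vec_lambda continuous_on_compose2[OF cont] continuous_intros) auto
  then have "P \<in> borel_measurable borel"
    by (rule borel_measurable_continuous_onI)
  then have "(\<lambda>t. P (w t)) \<in> borel_measurable (IT T)"
    using assms(1) by simp
  moreover have AE_P: "AE t in IT T. P (w t) = f t"
    using f by eventually_elim (simp add: P_def vec_eq_iff)
  ultimately have meas: "f \<in> borel_measurable (IT T)"
    by (rule borel_measurable_lebesgue_on_AE) auto
  obtain C where C: "\<And>y. y \<in> cbox (\<chi> i. a) (\<chi> i. b) \<Longrightarrow> norm (y::real^'n) \<le> C"
    using bounded_cbox unfolding bounded_iff by metis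
  have "norm (P y) \<le> C" for y
    using closest_point_in_set[of "{a..b}"] \<open>a \<le> b\<close>
    by (intro C) (auto simp: mem_box_cart P_def)
  then have "AE t in IT T. norm (P (w t)) \<le> C"
    by simp
  with AE_P have "AE t in IT T. norm (f t) \<le> C"
    by eventually_elim simp
  with meas show ?thesis
    by (auto simp: Linf_def)
qed

text \<open>The norm is extended-real valued; a real upper bound is what starts the geometric decay
  of the residuals.\<close>

lemma Linf_norm_finite:
  assumes "f \<in> Linf T"
  obtains C where "Linf_norm T f \<le> ereal C"
proof -
  obtain C where "AE t in IT T. ereal (norm (f t)) \<le> ereal C"
    using assms by (auto simp: Linf_def)
  then have "Linf_norm T f \<le> ereal C"
    using assms unfolding Linf_norm_def Linf_def by (intro esssup_I) auto
  then show thesis by (rule that)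
qed

lemma AE_norm_le_Linf_norm: "AE t in IT T. ereal (norm (f t)) \<le> Linf_norm T f"
  unfolding Linf_norm_def by (rule esssup_AE)

text \<open>Hoelder's inequality for the exponents 1 and infinity, with an arbitrary essential bound
  \<open>C\<close> in place of the norm of \<open>\<gamma>\<close>.\<close>

lemma
  assumes f: "f \<in> L1 T" and \<gamma>: "\<gamma> \<in> borel_measurable (IT T)" "AE t in IT T. norm (\<gamma> t) \<le> C"
  shows integrable_inner_Linf: "integrable (IT T) (\<lambda>t. f t \<bullet> \<gamma> t)"
    and abs_integral_inner_le: "\<bar>LINT t|IT T. f t \<bullet> \<gamma> t\<bar> \<le> C * (LINT t|IT T. norm (f t))"
proof -
  have int: "integrable (IT T) (\<lambda>t. C * norm (f t))"
    using f by (simp add: L1_def)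
  have meas: "(\<lambda>t. f t \<bullet> \<gamma> t) \<in> borel_measurable (IT T)"
    using f \<gamma>(1) by (auto simp: L1_def)
  have bound: "AE t in IT T. norm (f t \<bullet> \<gamma> t) \<le> C * norm (f t)"
    using \<gamma>(2)
  proof eventually_elim
    case (elim t)
    have "\<bar>f t \<bullet> \<gamma> t\<bar> \<le> norm (f t) * norm (\<gamma> t)"
      by (rule Cauchy_Schwarz_ineq2)
    also have "\<dots> \<le> norm (f t) * C"
      using elim by (intro mult_left_mono) auto
    finally show ?case by (simp add: mult.commute)
  qed
  show "integrable (IT T) (\<lambda>t. f t \<bullet> \<gamma> t)"
    by (rule Bochner_Integration.integrable_bound[OF int meas])
      (use bound in eventually_elim, auto)
  have "norm (LINT t|IT T. f t \<bullet> \<gamma> t) \<le> (LINT t|IT T. norm (f t \<bullet> \<gamma> t))"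
    by (rule integral_norm_bound)
  also have "\<dots> \<le> (LINT t|IT T. C * norm (f t))"
    using \<open>integrable (IT T) (\<lambda>t. f t \<bullet> \<gamma> t)\<close> int bound by (intro integral_mono_AE integrable_norm)
  finally show "\<bar>LINT t|IT T. f t \<bullet> \<gamma> t\<bar> \<le> C * (LINT t|IT T. norm (f t))"
    by simp
qed

text \<open>Supplies the functionals against which weak convergence is tested. Integrability of the
  products gives additivity, and the essential bound of \<open>\<gamma>\<close> is the operator
  bound.\<close>

lemma Linf_pairing_in_L1_dual:
  assumes "\<gamma> \<in> Linf T"
  shows "(\<lambda>f. LINT t|IT T. f t \<bullet> \<gamma> t) \<in> L1_dual T"
proof -
  obtain C where C: "\<gamma> \<in> borel_measurable (IT T)" "AE t in IT T. norm (\<gamma> t) \<le> C"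
    using assms by (auto simp: Linf_def)
  show ?thesis
    unfolding L1_dual_def
    using integrable_inner_Linf[OF _ C] abs_integral_inner_le[OF _ C]
    by (auto simp: inner_add_left intro!: exI[of _ C])
qed

subsection \<open>The gradient of the augmented Lagrangian\<close>

text \<open>\<open>grad\<close> is a definite description. A common derivative makes the two
  defining predicates equivalent, so the descriptions coincide without a gradient vector being
  constructed.\<close>

lemma grad_eq_if_same_derivative:
  assumes "(f1 has_derivative f') (at x)" "(f2 has_derivative f') (at x)"
  shows "grad f1 x = grad f2 x"
proof -
  have "(GDERIV f1 x :> D) \<longleftrightarrow> (GDERIV f2 x :> D)" for D
    unfolding gderiv_def using assms has_derivative_unique by metis
  then show ?thesis by (simp add: grad_def)
qed

text \<open>Away from 0 the function agrees locally with 0 or with the square; at 0 the difference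
  quotient is at most \<open>\<bar>h\<bar>\<close>. Squaring thus removes the kink of the maximum,
  and the penalty term is differentiable.\<close>

lemma has_field_derivative_max_0_power2:
  "((\<lambda>s::real. (max 0 s)\<^sup>2) has_field_derivative 2 * max 0 s) (at s)"
proof (cases s "0::real" rule: linorder_cases)
  case less
  have "((\<lambda>s::real. 0) has_field_derivative 0) (at s)" by simp
  moreover have "\<forall>\<^sub>F y in nhds s. (max 0 y)\<^sup>2 = (0::real)"
    using eventually_nhds_in_open[OF open_lessThan, of s "0"] less
    by (auto elim!: eventually_mono)
  ultimately show ?thesis
    using less DERIV_cong_ev[OF refl _ refl, where x = s and f = "\<lambda>y. (max 0 y)\<^sup>2" and g = "\<lambda>_. 0"
        and u = 0] by simp
next
  case greater
  have "((\<lambda>s::real. s\<^sup>2) has_field_derivative 2 * s) (at s)"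
    by (auto intro!: derivative_eq_intros)
  moreover have "\<forall>\<^sub>F y in nhds s. (max 0 y)\<^sup>2 = y\<^sup>2"
    using eventually_nhds_in_open[OF open_greaterThan, of s "0"] greater
    by (auto elim!: eventually_mono)
  ultimately show ?thesis
    using greater DERIV_cong_ev[OF refl _ refl, where x = s and f = "\<lambda>y. (max 0 y)\<^sup>2" and g = "\<lambda>y. y\<^sup>2"
        and u = "2 * s"] by simp
next
  case equal
  have "((\<lambda>h::real. (max 0 h)\<^sup>2 / h) \<longlongrightarrow> 0) (at 0)"
  proof (rule tendsto_rabs_zero_cancel, rule tendsto_sandwich[where f = "\<lambda>_. 0"])
    show "\<forall>\<^sub>F h in at (0::real). \<bar>(max 0 h)\<^sup>2 / h\<bar> \<le> \<bar>h\<bar>"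
      by (auto intro!: always_eventually simp: max_def power2_eq_square)
    show "((\<lambda>h::real. \<bar>h\<bar>) \<longlongrightarrow> 0) (at 0)"
      by (auto intro!: tendsto_eq_intros)
  qed auto
  then show ?thesis
    using equal by (simp add: DERIV_def)
qed

text \<open>The multipliers are frozen at \<open>z\<close> while \<open>y\<close> varies. By the
  chain rule the penalty terms contribute exactly these multipliers as coefficients of the
  derivatives of \<open>h\<close> and \<open>g\<close>.\<close>

lemma grad_Lagrangian_eq_grad_aug_Lagrangian:
  assumes "continuously_differentiable (\<lambda>y. \<phi> y t)"
    and "continuously_differentiable (\<lambda>y. (h y t, g y t))"
    and "\<rho> > 0"
  shows "grad (\<lambda>y. Lagrangian \<phi> h g y (\<chi> i. u $ i + \<rho> * h z t $ i)
             (\<chi> j. max (v $ j + \<rho> * g z t $ j) 0) t) z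
       = grad (\<lambda>y. aug_Lagrangian \<phi> h g \<rho> y u v t) z"
proof -
  obtain \<phi>' where \<phi>': "((\<lambda>y. \<phi> y t) has_derivative \<phi>') (at z)"
    using assms(1) by (auto simp: continuously_differentiable_def)
  obtain F where F: "((\<lambda>y. (h y t, g y t)) has_derivative F) (at z)"
    using assms(2) by (auto simp: continuously_differentiable_def)
  define h' where "h' = (\<lambda>i y. fst (F y) $ i)"
  define g' where "g' = (\<lambda>j y. snd (F y) $ j)"
  have h': "((\<lambda>y. h y t $ i) has_derivative h' i) (at z)" for i
    using has_derivative_fst[OF F] unfolding h'_def
    by (auto intro: bounded_linear.has_derivative[OF bounded_linear_vec_nth])
  have g': "((\<lambda>y. g y t $ j) has_derivative g' j) (at z)" for j
    using has_derivative_snd[OF F] unfolding g'_def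
    by (auto intro: bounded_linear.has_derivative[OF bounded_linear_vec_nth])
  define D where "D = (\<lambda>y. \<phi>' y + (\<Sum>i\<in>UNIV. (u $ i + \<rho> * h z t $ i) * h' i y)
    + (\<Sum>j\<in>UNIV. max (v $ j + \<rho> * g z t $ j) 0 * g' j y))"
  have sq_h: "((\<lambda>y. (h y t $ i + u $ i / \<rho>)\<^sup>2) has_derivative
      (\<lambda>y. 2 * (h z t $ i + u $ i / \<rho>) * h' i y)) (at z)" for i
    by (auto intro!: derivative_eq_intros h')
  have sq_g: "((\<lambda>y. (max 0 (g y t $ j + v $ j / \<rho>))\<^sup>2) has_derivative
      (\<lambda>y. 2 * max 0 (g z t $ j + v $ j / \<rho>) * g' j y)) (at z)" for j
  proof -
    have "((\<lambda>y. g y t $ j + v $ j / \<rho>) has_derivative g' j) (at z)"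
      by (auto intro!: derivative_eq_intros g')
    from has_derivative_compose[OF this
        has_field_derivative_max_0_power2[unfolded has_field_derivative_def]]
    show ?thesis .
  qed
  \<comment> \<open>The factor \<open>\<rho>\<close> left over by the chain rule moves inside the
    maximum because it is positive.\<close>
  have max_scale: "\<rho> * max 0 (g z t $ j + v $ j / \<rho>) = max (v $ j + \<rho> * g z t $ j) 0" for j
    using \<open>\<rho> > 0\<close> by (auto simp: max_def field_simps)
  have "((\<lambda>y. Lagrangian \<phi> h g y (\<chi> i. u $ i + \<rho> * h z t $ i)
      (\<chi> j. max (v $ j + \<rho> * g z t $ j) 0) t) has_derivative D) (at z)"
    unfolding Lagrangian_def D_def vec_lambda_beta
    by (intro has_derivative_add \<phi>' has_derivative_sum has_derivative_mult_right h' g')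
  moreover have "((\<lambda>y. aug_Lagrangian \<phi> h g \<rho> y u v t) has_derivative D) (at z)"
  proof -
    have "((\<lambda>y. aug_Lagrangian \<phi> h g \<rho> y u v t) has_derivative
      (\<lambda>y. \<phi>' y + \<rho> / 2 * (\<Sum>i\<in>UNIV. 2 * (h z t $ i + u $ i / \<rho>) * h' i y)
        + \<rho> / 2 * (\<Sum>j\<in>UNIV. 2 * max 0 (g z t $ j + v $ j / \<rho>) * g' j y))) (at z)"
      unfolding aug_Lagrangian_def
      by (intro has_derivative_add \<phi>' has_derivative_sum has_derivative_mult_right sq_h sq_g)
    also have "(\<lambda>y. \<phi>' y + \<rho> / 2 * (\<Sum>i\<in>UNIV. 2 * (h z t $ i + u $ i / \<rho>) * h' i y)
        + \<rho> / 2 * (\<Sum>j\<in>UNIV. 2 * max 0 (g z t $ j + v $ j / \<rho>) * g' j y)) = D"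
    proof -
      have "\<rho> / 2 * (2 * (h z t $ i + u $ i / \<rho>) * h' i y)
          = (u $ i + \<rho> * h z t $ i) * h' i y" for i y
        using \<open>\<rho> > 0\<close> by (simp add: field_simps)
      moreover have "\<rho> / 2 * (2 * max 0 (g z t $ j + v $ j / \<rho>) * g' j y)
          = max (v $ j + \<rho> * g z t $ j) 0 * g' j y" for j y
        by (simp flip: max_scale)
      ultimately show ?thesis
        unfolding D_def sum_distrib_left by (simp only:)
    qed
    finally show ?thesis .
  qed
  ultimately show ?thesis
    by (rule grad_eq_if_same_derivative)
qed

subsection \<open>Complementarity\<close>

text \<open>A nonzero product forces \<open>- v / \<rho> < s < 0\<close>. Then the maximum on the
  right of the first bound is \<open>s\<close>, the first factor is at most \<open>N\<close> because
  \<open>\<rho> * s < 0\<close>, and the second is \<open>- s\<close>, which is at most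
  \<open>N / \<rho>\<close>.\<close>

lemma multiplier_mult_neg_part_bounds:
  fixes \<rho> v s N :: real
  assumes "\<rho> > 0" "0 \<le> v" "v \<le> N"
  shows "\<bar>max (v + \<rho> * s) 0 * max (- s) 0\<bar> \<le> N * \<bar>max s (- v / \<rho>)\<bar>"
    and "\<bar>max (v + \<rho> * s) 0 * max (- s) 0\<bar> \<le> N * (N / \<rho>)"
proof -
  let ?p = "max (v + \<rho> * s) 0 * max (- s) 0"
  have "\<bar>?p\<bar> \<le> N * \<bar>max s (- v / \<rho>)\<bar> \<and> \<bar>?p\<bar> \<le> N * (N / \<rho>)"
  proof (cases "s < 0 \<and> v + \<rho> * s > 0")
    case True
    then have "- v / \<rho> < s"
      using \<open>\<rho> > 0\<close> by (simp add: field_simps)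
    moreover have "v / \<rho> \<le> N / \<rho>"
      using assms by (simp add: divide_right_mono)
    ultimately have "max s (- v / \<rho>) = s" "- s \<le> N / \<rho>"
      by auto
    have "?p = (v + \<rho> * s) * (- s)"
      using True by simp
    moreover have "(v + \<rho> * s) * (- s) \<ge> 0"
      using True by (intro mult_nonneg_nonneg) auto
    moreover have "v + \<rho> * s \<le> N"
      using True assms mult_pos_neg[of \<rho> s] by linarith
    then have "(v + \<rho> * s) * (- s) \<le> N * (- s)"
      using True by (intro mult_right_mono) auto
    moreover have "N * (- s) \<le> N * (N / \<rho>)"
      using \<open>- s \<le> N / \<rho>\<close> assms by (intro mult_left_mono) auto
    ultimately have "\<bar>?p\<bar> \<le> N * (- s)" "\<bar>?p\<bar> \<le> N * (N / \<rho>)"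
      by linarith+
    then show ?thesis
      using True \<open>max s (- v / \<rho>) = s\<close> by simp
  next
    case False
    then have "?p = 0" by (auto simp: max_def)
    show ?thesis unfolding \<open>?p = 0\<close> using assms by simp
  qed
  then show "\<bar>?p\<bar> \<le> N * \<bar>max s (- v / \<rho>)\<bar>" "\<bar>?p\<bar> \<le> N * (N / \<rho>)"
    by auto
qed

lemma unbounded_if_infinitely_often_multiplied:
  fixes \<rho> :: "nat \<Rightarrow> real"
  assumes "\<gamma> > 1" "\<rho> 0 > 0"
    and step: "\<And>k. \<rho> (Suc k) = \<rho> k \<or> \<rho> (Suc k) = \<gamma> * \<rho> k"
    and inf: "\<And>K. \<exists>k\<ge>K. \<rho> (Suc k) = \<gamma> * \<rho> k"
  shows "filterlim \<rho> at_top sequentially"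
proof -
  have pos: "\<rho> k > 0" for k
    by (induction k) (use assms(1,2) step in \<open>auto, metis mult_pos_pos less_trans zero_less_one\<close>)
  have mono: "incseq \<rho>"
  proof (rule incseq_SucI)
    fix k
    have "\<rho> k \<le> \<gamma> * \<rho> k"
      using \<open>\<gamma> > 1\<close> pos[of k] by simp
    then show "\<rho> k \<le> \<rho> (Suc k)"
      using step[of k] by auto
  qed
  \<comment> \<open>Induction on the number of multiplications: \<open>inf\<close> gives a further
    one at or beyond the index reached so far, and monotonicity carries the bound there.\<close>
  have reach: "\<exists>k. \<gamma> ^ n * \<rho> 0 \<le> \<rho> k" for n
  proof (induction n)
    case 0
    then show ?case by auto
  next
    case (Suc n)
    then obtain k where k: "\<gamma> ^ n * \<rho> 0 \<le> \<rho> k" by blast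
    obtain l where l: "l \<ge> k" "\<rho> (Suc l) = \<gamma> * \<rho> l"
      using inf by blast
    have "\<gamma> * (\<gamma> ^ n * \<rho> 0) \<le> \<gamma> * \<rho> l"
      using k incseqD[OF mono l(1)] \<open>\<gamma> > 1\<close> by (intro mult_left_mono) auto
    then show ?case
      using l(2) by (auto simp: mult.assoc intro!: exI[of _ "Suc l"])
  qed
  show ?thesis
    unfolding filterlim_at_top eventually_sequentially
  proof (intro allI)
    fix Z
    obtain n where "Z / \<rho> 0 < \<gamma> ^ n"
      using real_arch_pow[OF \<open>\<gamma> > 1\<close>] by blast
    then have "Z < \<gamma> ^ n * \<rho> 0"
      using \<open>\<rho> 0 > 0\<close> by (simp add: field_simps)
    then show "\<exists>k. \<forall>l\<ge>k. Z \<le> \<rho> l"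
      using reach[of n] incseqD[OF mono] by (meson less_imp_le order_trans)
  qed
qed

lemma ereal_geometric_decay:
  fixes r :: "nat \<Rightarrow> ereal"
  assumes "0 \<le> \<tau>" "r K \<le> ereal C" and step: "\<And>k. k \<ge> K \<Longrightarrow> r (Suc k) \<le> ereal \<tau> * r k"
  shows "r (K + n) \<le> ereal (C * \<tau> ^ n)"
proof (induction n)
  case 0
  then show ?case using assms by simp
next
  case (Suc n)
  have "r (K + Suc n) \<le> ereal \<tau> * r (K + n)"
    using step[of "K + n"] by simp
  also have "\<dots> \<le> ereal \<tau> * ereal (C * \<tau> ^ n)"
    using Suc \<open>0 \<le> \<tau>\<close> by (intro ereal_mult_left_mono) auto
  finally show ?case by (simp add: ac_simps)
qed

theorem theorem4p1:
  fixes T M N \<gamma> \<rho>1 \<tau> :: real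
    and \<phi> :: "real^'n \<Rightarrow> real \<Rightarrow> real"
    and h :: "real^'n \<Rightarrow> real \<Rightarrow> real^'p"
    and g :: "real^'n \<Rightarrow> real \<Rightarrow> real^'m"
    and x :: "nat \<Rightarrow> real \<Rightarrow> real^'n"
    and ut :: "nat \<Rightarrow> real \<Rightarrow> real^'p"
    and vt :: "nat \<Rightarrow> real \<Rightarrow> real^'m"
    and \<rho> :: "nat \<Rightarrow> real"
    and xbar :: "real \<Rightarrow> real^'n"
  assumes "T > 0"
    and "M > 0" "N > 0" "\<gamma> > 1" "\<rho>1 > 0" "0 < \<tau>" "\<tau> < 1"
    and "ALM_sequence T h g M N \<gamma> \<rho>1 \<tau> x ut vt \<rho>"
    and "xbar \<in> Linf T"
    and "AE t in IT T. (\<lambda>k. x k t) \<longlonglongrightarrow> xbar t"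
    and "xbar \<in> feasible_set T h g"
    and "H1_H2 T \<phi> h g xbar"
    and "H3 T \<phi> h g x ut vt \<rho>"
  shows "pw_AKKT_solution T \<phi> h g xbar"
proof -

  \<comment> \<open>Notation, index shift and positivity of the penalty parameters\<close>
  define R where "R = ALM_residual T h g x vt \<rho>"
  \<comment> \<open>The method counts its iterations from 1, an AKKT sequence from 0; hence the
    shift by \<open>Suc\<close>.\<close>
  define u where "u = (\<lambda>k. ALM_u h x ut \<rho> (Suc k))"
  define v where "v = (\<lambda>k. ALM_v g x vt \<rho> (Suc k))"
  note alm = assms(8)[unfolded ALM_sequence_def]
  have xL: "x k \<in> Linf T" for k
    using alm by blast
  have HL: "ALM_H h x (Suc k) \<in> Linf T" and VL: "ALM_V g x vt \<rho> (Suc k) \<in> Linf T" for k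
    using alm by auto
  have \<rho>_step: "\<rho> (Suc (Suc k)) = (if R (Suc k) \<le> ereal \<tau> * R k then \<rho> (Suc k)
      else \<gamma> * \<rho> (Suc k))" for k
    using alm unfolding R_def by (metis diff_Suc_1 le_add1 plus_1_eq_Suc)
  have \<rho>_pos: "\<rho> (Suc k) > 0" for k
  proof (induction k)
    case 0
    then show ?case using alm \<open>\<rho>1 > 0\<close> by simp
  next
    case (Suc k)
    then show ?case using \<rho>_step[of k] \<open>\<gamma> > 1\<close> by simp
  qed

  \<comment> \<open>Essential boundedness of the multipliers\<close>
  have u_eq: "u k = (\<lambda>t. ut (Suc k) t + \<rho> (Suc k) *\<^sub>R ALM_H h x (Suc k) t)" for k
    by (simp add: u_def ALM_u_def ALM_H_def vec_eq_iff fun_eq_iff)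
  \<comment> \<open>Factoring \<open>\<rho>\<close> out of the maximum expresses \<open>v\<close>
    through \<open>ALM_V\<close>, whose essential boundedness is part of the method.\<close>
  have v_eq: "v k = (\<lambda>t. vt (Suc k) t + \<rho> (Suc k) *\<^sub>R ALM_V g x vt \<rho> (Suc k) t)" for k
    using \<rho>_pos[of k]
    by (auto simp: v_def ALM_v_def ALM_V_def vec_eq_iff fun_eq_iff max_def field_simps)
  \<comment> \<open>Only the initial multiplier is given as essentially bounded. Each later one is a
    projection of \<open>u k\<close>, whose measurability comes from the previous
    multiplier.\<close>
  have utL: "ut (Suc k) \<in> Linf T" for k
  proof (induction k)
    case 0
    then show ?case using alm by simp
  next
    case (Suc k)
    have "u k \<in> borel_measurable (IT T)"
      using Linf_scaleR_add[OF Suc HL] by (simp add: u_eq Linf_def)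
    then show ?case
      by (rule Linf_closest_point[where a = "-M" and b = M]) (use alm \<open>M > 0\<close> in \<open>auto simp: u_def\<close>)
  qed
  have vtL: "vt (Suc k) \<in> Linf T" for k
  proof (induction k)
    case 0
    then show ?case using alm by simp
  next
    case (Suc k)
    have "v k \<in> borel_measurable (IT T)"
      using Linf_scaleR_add[OF Suc VL] by (simp add: v_eq Linf_def)
    then show ?case
      by (rule Linf_closest_point[where a = 0 and b = N]) (use alm \<open>N > 0\<close> in \<open>auto simp: v_def\<close>)
  qed
  have vt_bounds: "AE t in IT T. \<forall>j. 0 \<le> vt (Suc k) t $ j \<and> vt (Suc k) t $ j \<le> N" for k
  proof (cases k)
    case 0
    then show ?thesis using alm by simp
  next
    case (Suc l)
    have "AE t in IT T. \<forall>j. vt (Suc k) t $ j = closest_point {0..N} (v l t $ j)"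
      using alm unfolding v_def Suc by simp
    then show ?thesis
    proof eventually_elim
      case (elim t)
      then show ?case
        using closest_point_in_set[of "{0..N}"] \<open>N > 0\<close> by auto
    qed
  qed

  \<comment> \<open>Stationarity\<close>
  obtain \<epsilon> where \<epsilon>: "\<forall>k\<ge>1. \<epsilon> k \<in> L1 T"
      "\<forall>k\<ge>1. AE t in IT T. grad (\<lambda>y. aug_Lagrangian \<phi> h g (\<rho> k) y (ut k t) (vt k t) t) (x k t) = \<epsilon> k t"
    and \<epsilon>_weak: "weakly_converges_L1 T \<epsilon> (\<lambda>_. 0)"
    using assms(13) unfolding H3_def by blast
  have \<epsilon>L: "\<epsilon> (Suc k) \<in> L1 T"
    and \<epsilon>_eq: "AE t in IT T. grad (\<lambda>y. aug_Lagrangian \<phi> h g (\<rho> (Suc k)) y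
        (ut (Suc k) t) (vt (Suc k) t) t) (x (Suc k) t) = \<epsilon> (Suc k) t" for k
    using \<epsilon> by auto
  have diff: "AE t in IT T. continuously_differentiable (\<lambda>y. \<phi> y t)"
    "AE t in IT T. continuously_differentiable (\<lambda>y. (h y t, g y t))"
    using assms(12) by (auto simp: H1_H2_def H1_def H2_def)
  have grad_eq: "AE t in IT T.
      grad (\<lambda>y. Lagrangian \<phi> h g y (u k t) (v k t) t) (x (Suc k) t) = \<epsilon> (Suc k) t" for k
    using diff \<epsilon>_eq[of k]
  proof eventually_elim
    case (elim t)
    then show ?case
      using grad_Lagrangian_eq_grad_aug_Lagrangian[of \<phi> t h g, OF elim(1,2) \<rho>_pos[of k]]
      by (simp add: u_def v_def ALM_u_def ALM_v_def)
  qed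
  have stationary: "(\<forall>k. integrable (IT T) (\<lambda>t. grad (\<lambda>y. Lagrangian \<phi> h g y (u k t) (v k t) t)
          (x (Suc k) t) \<bullet> \<eta> t)) \<and>
      (\<lambda>k. LINT t|IT T. grad (\<lambda>y. Lagrangian \<phi> h g y (u k t) (v k t) t)
          (x (Suc k) t) \<bullet> \<eta> t) \<longlonglongrightarrow> 0"
    if \<eta>: "\<eta> \<in> Linf T" for \<eta>
  proof -
    let ?G = "\<lambda>k t. grad (\<lambda>y. Lagrangian \<phi> h g y (u k t) (v k t) t) (x (Suc k) t)"
    obtain C where C: "\<eta> \<in> borel_measurable (IT T)" "AE t in IT T. norm (\<eta> t) \<le> C"
      using \<eta> by (auto simp: Linf_def)
    have int: "integrable (IT T) (\<lambda>t. \<epsilon> (Suc k) t \<bullet> \<eta> t)" for k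
      by (rule integrable_inner_Linf[OF \<epsilon>L C])
    have eq: "AE t in IT T. \<epsilon> (Suc k) t \<bullet> \<eta> t = ?G k t \<bullet> \<eta> t" for k
      using grad_eq[of k] by eventually_elim simp
    \<comment> \<open>Measurability is known for \<open>\<epsilon>\<close> and is transferred to the
      gradient by equality almost everywhere.\<close>
    have meas: "(\<lambda>t. ?G k t \<bullet> \<eta> t) \<in> borel_measurable (IT T)" for k
      by (rule borel_measurable_lebesgue_on_AE[OF borel_measurable_integrable[OF int] eq]) auto
    have "integrable (IT T) (\<lambda>t. ?G k t \<bullet> \<eta> t)" for k
      by (rule integrable_cong_AE_imp[OF int meas eq])
    moreover have "(LINT t|IT T. ?G k t \<bullet> \<eta> t) = (LINT t|IT T. \<epsilon> (Suc k) t \<bullet> \<eta> t)" for k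
      using integral_cong_AE[OF borel_measurable_integrable[OF int] meas eq] by simp
    moreover have "(\<lambda>k. LINT t|IT T. \<epsilon> k t \<bullet> \<eta> t) \<longlonglongrightarrow> 0"
      using \<epsilon>_weak Linf_pairing_in_L1_dual[OF \<eta>] by (fastforce simp: weakly_converges_L1_def)
    then have "(\<lambda>k. LINT t|IT T. \<epsilon> (Suc k) t \<bullet> \<eta> t) \<longlonglongrightarrow> 0"
      by (rule LIMSEQ_Suc)
    ultimately show ?thesis
      by simp
  qed

  \<comment> \<open>Complementarity in the limit\<close>
  have compl: "AE t in IT T. (\<lambda>k. v k t $ j * max (- g (x (Suc k) t) t $ j) 0) \<longlonglongrightarrow> 0" for j
  proof (cases "\<exists>K. \<forall>k\<ge>K. R (Suc k) \<le> ereal \<tau> * R k")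
    case True
    \<comment> \<open>Starting at \<open>Suc K\<close> keeps the index at least 1, where the method
      guarantees that the residual is finite.\<close>
    then obtain K where K: "\<And>k. k \<ge> Suc K \<Longrightarrow> R (Suc k) \<le> ereal \<tau> * R k"
      by (meson Suc_leD)
    obtain C where C: "R (Suc K) \<le> ereal C"
    proof -
      obtain A B where "Linf_norm T (ALM_H h x (Suc K)) \<le> ereal A"
        "Linf_norm T (ALM_V g x vt \<rho> (Suc K)) \<le> ereal B"
        using Linf_norm_finite[OF HL] Linf_norm_finite[OF VL] by metis
      then have "R (Suc K) \<le> ereal (max A B)"
        unfolding R_def ALM_residual_def by (auto simp: max_def intro: order_trans)
      then show thesis by (rule that)
    qed
    have "AE t in IT T. ereal (norm (ALM_V g x vt \<rho> k t)) \<le> R k" for k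
      using AE_norm_le_Linf_norm[of "ALM_V g x vt \<rho> k" T]
      by eventually_elim (simp add: R_def ALM_residual_def le_max_iff_disj)
    \<comment> \<open>Countably many null sets are merged, so that a single \<open>t\<close> can be
      fixed for all iterations.\<close>
    then have V_AE: "AE t in IT T. \<forall>k. ereal (norm (ALM_V g x vt \<rho> k t)) \<le> R k"
      by (simp add: AE_all_countable)
    have "AE t in IT T. \<forall>k j. 0 \<le> vt (Suc k) t $ j \<and> vt (Suc k) t $ j \<le> N"
      using vt_bounds by (simp add: AE_all_countable)
    with V_AE show ?thesis
    proof eventually_elim
      case (elim t)
      have "norm (v (K + n) t $ j * max (- g (x (Suc (K + n)) t) t $ j) 0) \<le> N * (C * \<tau> ^ n)"
        for n
      proof -
        \<comment> \<open>\<open>v (K + n)\<close> belongs to iteration \<open>Suc (K + n)\<close>,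
          which lies \<open>n\<close> steps after the start of the decay.\<close>
        let ?V = "ALM_V g x vt \<rho> (Suc (K + n)) t"
        have "ereal (norm ?V) \<le> R (Suc K + n)"
          using elim by simp
        also have "\<dots> \<le> ereal (C * \<tau> ^ n)"
          using ereal_geometric_decay[of \<tau> R "Suc K" C n] K C \<open>0 < \<tau>\<close> by simp
        finally have "norm ?V \<le> C * \<tau> ^ n" by simp
        then have "\<bar>?V $ j\<bar> \<le> C * \<tau> ^ n"
          using component_le_norm_cart[of ?V j] by linarith
        then have "N * \<bar>?V $ j\<bar> \<le> N * (C * \<tau> ^ n)"
          using \<open>N > 0\<close> by simp
        moreover have "?V $ j = max (g (x (Suc (K + n)) t) t $ j)
            (- vt (Suc (K + n)) t $ j / \<rho> (Suc (K + n)))"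
          by (simp add: ALM_V_def)
        ultimately show ?thesis
          using multiplier_mult_neg_part_bounds(1)[OF \<rho>_pos, of "vt (Suc (K + n)) t $ j" N "K + n"
              "g (x (Suc (K + n)) t) t $ j"] elim(2)
          by (auto simp: v_def ALM_v_def)
      qed
      moreover have "(\<lambda>n. N * (C * \<tau> ^ n)) \<longlonglongrightarrow> 0"
        using \<open>0 < \<tau>\<close> \<open>\<tau> < 1\<close> by (auto intro!: tendsto_mult_right_zero LIMSEQ_power_zero)
      ultimately have
        "(\<lambda>n. v (K + n) t $ j * max (- g (x (Suc (K + n)) t) t $ j) 0) \<longlonglongrightarrow> 0"
        by (rule Lim_null_comparison[OF always_eventually[OF allI]])
      then show ?case
        using LIMSEQ_offset[of "\<lambda>k. v k t $ j * max (- g (x (Suc k) t) t $ j) 0" K]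
        by (simp add: add.commute)
    qed
  next
    case False
    \<comment> \<open>The penalty test fails infinitely often, and each failure multiplies the
      parameter by \<open>\<gamma>\<close>. The shifted sequence starts at the given positive value
      \<open>\<rho> 1\<close>.\<close>
    have "filterlim (\<lambda>k. \<rho> (Suc k)) at_top sequentially"
    proof (rule unbounded_if_infinitely_often_multiplied[OF \<open>\<gamma> > 1\<close> \<rho>_pos])
      show "\<rho> (Suc (Suc k)) = \<rho> (Suc k) \<or> \<rho> (Suc (Suc k)) = \<gamma> * \<rho> (Suc k)" for k
        using \<rho>_step[of k] by simp
      show "\<exists>k\<ge>K. \<rho> (Suc (Suc k)) = \<gamma> * \<rho> (Suc k)" for K
        using False \<rho>_step by metis
    qed
    then have lim: "(\<lambda>k. N * (N / \<rho> (Suc k))) \<longlonglongrightarrow> 0"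
      by (intro tendsto_mult_right_zero tendsto_divide_0[OF tendsto_const]
          filterlim_at_top_imp_at_infinity)
    have "AE t in IT T. \<forall>k j. 0 \<le> vt (Suc k) t $ j \<and> vt (Suc k) t $ j \<le> N"
      using vt_bounds by (simp add: AE_all_countable)
    then show ?thesis
    proof eventually_elim
      case (elim t)
      show ?case
      proof (rule Lim_null_comparison[OF always_eventually[OF allI] lim])
        show "norm (v k t $ j * max (- g (x (Suc k) t) t $ j) 0) \<le> N * (N / \<rho> (Suc k))" for k
          using multiplier_mult_neg_part_bounds(2)[OF \<rho>_pos, of "vt (Suc k) t $ j" N k
              "g (x (Suc k) t) t $ j"] elim
          by (auto simp: v_def ALM_v_def)
      qed
    qed
  qed

  \<comment> \<open>Assembling the AKKT sequence\<close>
  have "AKKT_sequence T \<phi> h g (\<lambda>k. x (Suc k)) u v"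
    unfolding AKKT_sequence_def
  proof (intro conjI allI ballI)
    show "x (Suc k) \<in> Linf T" "u k \<in> Linf T" "v k \<in> Linf T" for k
      using xL Linf_scaleR_add[OF utL HL] Linf_scaleR_add[OF vtL VL] by (simp_all add: u_eq v_eq)
    show "AE t in IT T. 0 \<le> v k t $ j" for k j
      by (simp add: v_def ALM_v_def)
  qed (use stationary compl in auto)
  moreover have "AE t in IT T. (\<lambda>k. x (Suc k) t) \<longlonglongrightarrow> xbar t"
    using assms(10) by eventually_elim (rule LIMSEQ_Suc)
  ultimately show ?thesis
    unfolding pw_AKKT_solution_def using assms(11,12) by blast
qed

end
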